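(* Let $G$ be a connected graph with vertex set $\{1,\dots,n\}$, $n\ge 2$, let $\Phi=(F_1,\dots,F_n)$ be an $n$-tuple of pairwise disjoint graphs with $|V(F_i)|\ge 3$ for all $i$, and let $G[\Phi]$ be the generalized lexicographic product. Then (i) $\gamma(G[\Phi])\equiv\gamma_r(G[\Phi])\equiv\gamma^{oc}(G[\Phi])$, and (ii) $\gamma_t(G[\Phi])\equiv\gamma_{tr}(G[\Phi])\equiv\gamma_t^{oc}(G[\Phi])$.
   Context: All graphs are finite, simple and undirected. The generalized lexicographic product $G[\Phi]$ is the graph with vertex set $\bigcup_{i=1}^n V(F_i)$ in which each $F_i$ is an induced subgraph, and for $x\in V(F_i)$, $y\in V(F_j)$ with $i\neq j$, $xy$ is an edge iff $ij\in E(G)$. For a graph $H$ and $S\subseteq V(H)$: $S$ is dominating if every vertex outside $S$ has a neighbor in $S$; total dominating if every vertex of $H$ has a neighbor in $S$; a dominating set $S$ is restrained if every vertex outside $S$ has a neighbor outside $S$, and outer-connected if the subgraph induced by $V(H)\setminus S$ is connected. $\gamma,\gamma_t,\gamma_r,\gamma_{tr},\gamma^{oc},\gamma_t^{oc}$ denote the minimum cardinalities of, respectively, dominating, total dominating, restrained dominating, total restrained dominating (total and restrained), outer-connected dominating, and total outer-connected dominating (total and outer-connected) sets; a $\nu$-set is a set of the type corresponding to $\nu$ of cardinality $\nu(H)$. For two such parameters $\mu,\nu$, we write $\mu(H)\equiv\nu(H)$ (strongly equal) if the set of all $\mu$-sets of $H$ coincides with the set of all $\nu$-sets of $H$. *)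

theory Defs
  imports "Graph_Theory.Digraph_Component" "HOL-Library.Disjoint_Sets"
begin

text \<open>
  A finite simple undirected graph is a \<^locale>\<open>pair_graph\<close>: a finite, loop-free, symmetric
  digraph whose arcs are pairs of vertices. An edge \<open>xy\<close> is the pair of arcs \<open>(x, y)\<close>, \<open>(y, x)\<close>.
\<close>

definition lex_product :: "'i pair_pre_digraph \<Rightarrow> ('i \<Rightarrow> 'a pair_pre_digraph) \<Rightarrow> 'a pair_pre_digraph"
  where
  "lex_product G F = \<lparr>
     pverts = (\<Union>i\<in>pverts G. pverts (F i)),
     parcs = (\<Union>i\<in>pverts G. parcs (F i)) \<union>
             {(x, y). \<exists>i\<in>pverts G. \<exists>j\<in>pverts G. i \<noteq> j \<and> (i, j) \<in> parcs G \<and>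
                        x \<in> pverts (F i) \<and> y \<in> pverts (F j)} \<rparr>"

definition dominating :: "'a pair_pre_digraph \<Rightarrow> 'a set \<Rightarrow> bool" where
  "dominating H S \<longleftrightarrow>
     S \<subseteq> pverts H \<and> (\<forall>v\<in>pverts H - S. \<exists>u\<in>S. (v, u) \<in> parcs H)"

definition total_dominating :: "'a pair_pre_digraph \<Rightarrow> 'a set \<Rightarrow> bool" where
  "total_dominating H S \<longleftrightarrow>
     S \<subseteq> pverts H \<and> (\<forall>v\<in>pverts H. \<exists>u\<in>S. (v, u) \<in> parcs H)"

definition restrained_dominating :: "'a pair_pre_digraph \<Rightarrow> 'a set \<Rightarrow> bool" where
  "restrained_dominating H S \<longleftrightarrow>
     dominating H S \<and> (\<forall>v\<in>pverts H - S. \<exists>u\<in>pverts H - S. (v, u) \<in> parcs H)"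

text \<open>
  Connectedness in the library includes nonemptiness, so the full vertex set is never
  outer-connected.
\<close>

definition outer_connected_dominating :: "'a pair_pre_digraph \<Rightarrow> 'a set \<Rightarrow> bool" where
  "outer_connected_dominating H S \<longleftrightarrow>
     dominating H S \<and> Digraph_Component.connected (with_proj H \<restriction> (pverts H - S))"

definition total_restrained_dominating :: "'a pair_pre_digraph \<Rightarrow> 'a set \<Rightarrow> bool" where
  "total_restrained_dominating H S \<longleftrightarrow> total_dominating H S \<and> restrained_dominating H S"

definition total_outer_connected_dominating :: "'a pair_pre_digraph \<Rightarrow> 'a set \<Rightarrow> bool" where
  "total_outer_connected_dominating H S \<longleftrightarrow>
     total_dominating H S \<and> outer_connected_dominating H S"

text \<open>
  A parameter \<open>\<nu>\<close> is represented by the predicate \<open>P\<close> defining its type of sets: the number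
  \<open>\<nu>(H)\<close> is \<open>min_card P H\<close>, and the \<open>\<nu>\<close>-sets of \<open>H\<close> form \<open>min_sets P H\<close>. If \<open>H\<close> has no set of
  type \<open>P\<close>, then \<open>min_card P H\<close> is unspecified and \<open>min_sets P H\<close> is empty.
\<close>

definition min_card :: "('a pair_pre_digraph \<Rightarrow> 'a set \<Rightarrow> bool) \<Rightarrow> 'a pair_pre_digraph \<Rightarrow> nat" where
  "min_card P H = (LEAST k. \<exists>S. P H S \<and> card S = k)"

definition min_sets :: "('a pair_pre_digraph \<Rightarrow> 'a set \<Rightarrow> bool) \<Rightarrow> 'a pair_pre_digraph \<Rightarrow> 'a set set"
  where "min_sets P H = {S. P H S \<and> card S = min_card P H}"

definition strongly_equal ::
    "'a pair_pre_digraph \<Rightarrow> ('a pair_pre_digraph \<Rightarrow> 'a set \<Rightarrow> bool) \<Rightarrow>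
     ('a pair_pre_digraph \<Rightarrow> 'a set \<Rightarrow> bool) \<Rightarrow> bool" where
  "strongly_equal H P Q \<longleftrightarrow> min_sets P H = min_sets Q H"

lemma pair_graph_lex_product:
  assumes G: "pair_graph G" and F: "\<And>i. i \<in> pverts G \<Longrightarrow> pair_graph (F i)"
    and disj: "disjoint_family_on (\<lambda>i. pverts (F i)) (pverts G)"
  shows "pair_graph (lex_product G F)"
proof -
  interpret G: pair_graph G by fact
  have wf: "x \<in> pverts (F i)" "y \<in> pverts (F i)" "x \<noteq> y" "(y, x) \<in> parcs (F i)"
    if "i \<in> pverts G" "(x, y) \<in> parcs (F i)" for i x y
  proof -
    interpret Fi: pair_graph "F i" using F that by blast
    show "x \<in> pverts (F i)" "y \<in> pverts (F i)" "x \<noteq> y" "(y, x) \<in> parcs (F i)"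
      using that Fi.arc_fst_in_verts Fi.arc_snd_in_verts Fi.pair_no_loops Fi.arcs_symmetric
      by fastforce+
  qed
  have fin: "finite (pverts (F i))" if "i \<in> pverts G" for i
    using F[OF that] unfolding pair_graph_def pair_digraph_def pair_fin_digraph_def
      pair_fin_digraph_axioms_def by blast
  have finV: "finite (pverts (lex_product G F))"
    using fin G.pair_finite_verts by (simp add: lex_product_def)
  have arcs: "(x, y) \<in> parcs (lex_product G F) \<Longrightarrow>
      x \<in> pverts (lex_product G F) \<and> y \<in> pverts (lex_product G F) \<and> x \<noteq> y
      \<and> (y, x) \<in> parcs (lex_product G F)" for x y
  proof -
    assume "(x, y) \<in> parcs (lex_product G F)"
    then consider i where "i \<in> pverts G" "(x, y) \<in> parcs (F i)"
      | i j where "i \<in> pverts G" "j \<in> pverts G" "i \<noteq> j" "(i, j) \<in> parcs G"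
          "x \<in> pverts (F i)" "y \<in> pverts (F j)"
      by (auto simp: lex_product_def)
    then show ?thesis
    proof cases
      case 1
      then show ?thesis using wf[OF 1] by (auto simp: lex_product_def)
    next
      case 2
      have "x \<noteq> y" using 2 disj by (auto simp: disjoint_family_on_def)
      moreover have "(j, i) \<in> parcs G" using 2 G.arcs_symmetric by blast
      ultimately show ?thesis using 2 not_sym[OF 2(3)] unfolding lex_product_def by simp blast
    qed
  qed
  have "parcs (lex_product G F) \<subseteq> pverts (lex_product G F) \<times> pverts (lex_product G F)"
    using arcs by auto
  then have finA: "finite (parcs (lex_product G F))"
    using finV by (meson finite_SigmaI finite_subset)
  show ?thesis
    by unfold_locales (use arcs finV finA in \<open>auto simp: symmetric_def intro!: symI\<close>)
qed

lemma induced_subgraph_lex_product: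
  assumes G: "pair_graph G" and F: "\<And>i. i \<in> pverts G \<Longrightarrow> pair_graph (F i)"
    and disj: "disjoint_family_on (\<lambda>i. pverts (F i)) (pverts G)"
    and i: "i \<in> pverts G"
  shows "induced_subgraph (with_proj (F i)) (with_proj (lex_product G F))"
proof -
  interpret L: pair_graph "lex_product G F"
    using pair_graph_lex_product[OF G F disj] by blast
  interpret Fi: pair_graph "F i" using F i by blast
  have uniq: "j = i" if "j \<in> pverts G" "x \<in> pverts (F j)" "x \<in> pverts (F i)" for j x
    using disj i that by (auto simp: disjoint_family_on_def)
  have sub: "subgraph (with_proj (F i)) (with_proj (lex_product G F))"
    using i Fi.wf_digraph L.wf_digraph
    by (auto simp: subgraph_def compatible_def lex_product_def)
  have "(x, y) \<in> parcs (F i)"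
    if a: "(x, y) \<in> parcs (lex_product G F)" and x: "x \<in> pverts (F i)" and y: "y \<in> pverts (F i)"
    for x y
  proof -
    have "x \<in> pverts (F j)" if "j \<in> pverts G" "(x, y) \<in> parcs (F j)" for j
    proof -
      interpret Fj: pair_graph "F j" using F that by blast
      show ?thesis using that Fj.in_arcsD1 by blast
    qed
    moreover have "\<not> (k \<noteq> l \<and> x \<in> pverts (F k) \<and> y \<in> pverts (F l))"
      if "k \<in> pverts G" "l \<in> pverts G" for k l
      using uniq that x y by metis
    ultimately show ?thesis using a x uniq unfolding lex_product_def by fastforce
  qed
  moreover have "parcs (F i) \<subseteq> parcs (lex_product G F)"
    using i by (auto simp: lex_product_def)
  ultimately show ?thesis
    using sub Fi.in_arcsD1 Fi.in_arcsD2 by (auto simp: induced_subgraph_def)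
qed

lemma lex_product_arc_iff:
  assumes F: "\<And>i. i \<in> pverts G \<Longrightarrow> pair_graph (F i)"
    and disj: "disjoint_family_on (\<lambda>i. pverts (F i)) (pverts G)"
    and "i \<in> pverts G" "j \<in> pverts G" "i \<noteq> j" "x \<in> pverts (F i)" "y \<in> pverts (F j)"
  shows "(x, y) \<in> parcs (lex_product G F) \<longleftrightarrow> (i, j) \<in> parcs G"
proof -
  have uniq: "k = l" if "k \<in> pverts G" "l \<in> pverts G" "z \<in> pverts (F k)" "z \<in> pverts (F l)" for k l z
    using disj that by (auto simp: disjoint_family_on_def)
  have "x \<in> pverts (F k) \<and> y \<in> pverts (F k)" if "k \<in> pverts G" "(x, y) \<in> parcs (F k)" for k
  proof -
    interpret Fk: pair_graph "F k" using F that by blast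
    show ?thesis using that Fk.in_arcsD1 Fk.in_arcsD2 by blast
  qed
  then have no: "(x, y) \<notin> parcs (F k)" if "k \<in> pverts G" for k
    using uniq assms(3-) that by metis
  show ?thesis
  proof
    assume "(x, y) \<in> parcs (lex_product G F)"
    then obtain k l where "k \<in> pverts G" "l \<in> pverts G" "(k, l) \<in> parcs G"
        "x \<in> pverts (F k)" "y \<in> pverts (F l)"
      using no by (auto simp: lex_product_def)
    then show "(i, j) \<in> parcs G" using uniq assms(3-) by metis
  next
    assume "(i, j) \<in> parcs G"
    then show "(x, y) \<in> parcs (lex_product G F)"
      using assms(3-) by (auto simp: lex_product_def)
  qed
qed

end

theory Submission
  imports Defs
begin

text \<open>
  A minimum (total) dominating set \<open>S\<close> never contains a whole fibre \<open>F i\<close>: as \<open>F i\<close> has at least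
  three vertices, replacing it in \<open>S\<close> by one vertex of \<open>F i\<close> and one vertex of an adjacent fibre
  \<open>F j\<close> gives a smaller (total) dominating set. So the complement of \<open>S\<close> meets every fibre, and a
  set that meets every fibre induces a connected subgraph without isolated vertices because \<open>G\<close> is
  connected with at least two vertices.
\<close>

lemma min_card_le: "P H S \<Longrightarrow> min_card P H \<le> card S"
  unfolding min_card_def by (rule Least_le) blast

lemma min_card_attained:
  assumes "P H S"
  obtains T where "P H T" "card T = min_card P H"
  using LeastI_ex[of "\<lambda>k. \<exists>S. P H S \<and> card S = k"] assms unfolding min_card_def by blast

text \<open>Any set of type \<open>Q\<close> has type \<open>P\<close>, so the minimum for
  \<open>P\<close> is at most that for \<open>Q\<close>; a minimum \<open>P\<close>-set of type
  \<open>Q\<close> gives the reverse bound. Once the minima agree, membership transfers both ways.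
  If no set of type \<open>P\<close> exists, both families are empty.\<close>

lemma strongly_equalI:
  assumes PQ: "\<And>S. S \<in> min_sets P H \<Longrightarrow> Q H S" and QP: "\<And>S. Q H S \<Longrightarrow> P H S"
  shows "strongly_equal H P Q"
proof -
  have eq: "min_card P H = min_card Q H" if S: "P H S" for S
  proof (rule antisym)
    obtain T where T: "P H T" "card T = min_card P H" using min_card_attained[of P, OF S] by blast
    then have "Q H T" using PQ by (simp add: min_sets_def)
    then show "min_card Q H \<le> min_card P H" using min_card_le T by metis
    obtain U where "Q H U" "card U = min_card Q H" using min_card_attained[of Q, OF \<open>Q H T\<close>] by blast
    then show "min_card P H \<le> min_card Q H" using min_card_le QP by metis
  qed
  have "min_sets P H = min_sets Q H"
  proof (intro set_eqI iffI)
    fix S assume S: "S \<in> min_sets P H"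
    then show "S \<in> min_sets Q H" using eq[of S] PQ[OF S] by (simp add: min_sets_def)
  next
    fix S assume "S \<in> min_sets Q H"
    then show "S \<in> min_sets P H" using eq[OF QP[of S]] QP[of S] by (simp add: min_sets_def)
  qed
  then show ?thesis unfolding strongly_equal_def .
qed

text \<open>At least three elements leave and at most two enter; \<open>x\<close> and
  \<open>y\<close> may coincide or already lie in \<open>S - A\<close>. This is where the fibre size
  three matters.\<close>

lemma card_exchange_less:
  assumes "finite S" "A \<subseteq> S" "card A \<ge> 3"
  shows "card (insert x (insert y (S - A))) < card S"
proof -
  have "card (insert x (insert y (S - A))) \<le> Suc (Suc (card (S - A)))"
    using assms(1) by (simp add: card_insert_if)
  moreover have "card (S - A) = card S - card A" "card A \<le> card S"
    using assms by (auto intro: card_Diff_subset card_mono finite_subset)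
  ultimately show ?thesis using assms(3) by linarith
qed

text \<open>A symmetric connected digraph is strongly connected, so \<open>u\<close> reaches some
  other vertex \<open>w\<close>, and the first arc of a walk to \<open>w\<close> leads to a
  neighbour.\<close>

lemma (in pair_graph) connected_imp_neighbour:
  assumes "Digraph_Component.connected (with_proj G)" "card (pverts G) \<ge> 2" "u \<in> pverts G"
  obtains v where "(u, v) \<in> parcs G"
proof -
  have "\<not> pverts G \<subseteq> {u}"
    using assms(2) card_mono[of "{u}" "pverts G"] by auto
  then obtain w where w: "w \<in> pverts G" "w \<noteq> u" by blast
  have "strongly_connected (with_proj G)"
    using assms(1) symmetric_connected_imp_strongly_connected sym_arcs by blast
  then have "u \<rightarrow>\<^sup>*\<^bsub>with_proj G\<^esub> w" using assms(3) w(1) by (auto simp: strongly_connected_def)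
  then show thesis
    by (cases rule: converse_reachable_cases) (use w that in auto)
qed

locale connected_lex_product = G: pair_graph G
  for G :: "'i pair_pre_digraph" and F :: "'i \<Rightarrow> 'a pair_pre_digraph" +
  assumes factors: "\<And>i. i \<in> pverts G \<Longrightarrow> pair_graph (F i)"
    and disjoint: "disjoint_family_on (\<lambda>i. pverts (F i)) (pverts G)"
    and connected: "Digraph_Component.connected (with_proj G)"
    and card_ge2: "card (pverts G) \<ge> 2"
    and card_fibre: "\<And>i. i \<in> pverts G \<Longrightarrow> card (pverts (F i)) \<ge> 3"
begin

abbreviation H :: "'a pair_pre_digraph" where "H \<equiv> lex_product G F"

sublocale H: pair_graph H
  by (rule pair_graph_lex_product[OF G.pair_graph_axioms factors disjoint])

lemma pverts_H: "pverts H = (\<Union>i\<in>pverts G. pverts (F i))"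
  by (simp add: lex_product_def)

lemma arc_between_fibres:
  assumes "(i, j) \<in> parcs G" "x \<in> pverts (F i)" "y \<in> pverts (F j)"
  shows "(x, y) \<in> parcs H"
proof -
  have "i \<noteq> j" using assms(1) G.pair_no_loops by fastforce
  then show ?thesis
    using assms G.in_arcsD1[OF assms(1)] G.in_arcsD2[OF assms(1)]
    by (auto simp: lex_product_def)
qed

text \<open>Each fibre is a module of \<open>H\<close>: arcs between distinct fibres depend only on
  the indices, so a vertex outside \<open>F i\<close> is adjacent to all of it or to none of
  it.\<close>

lemma arc_from_outside_fibre:
  assumes i: "i \<in> pverts G" and arc: "(v, u) \<in> parcs H"
    and u: "u \<in> pverts (F i)" and v: "v \<notin> pverts (F i)" and x: "x \<in> pverts (F i)"
  shows "(v, x) \<in> parcs H"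
proof -
  obtain k where k: "k \<in> pverts G" "v \<in> pverts (F k)"
    using H.in_arcsD1[OF arc] pverts_H by blast
  then have "k \<noteq> i" using v by blast
  then show ?thesis
    using lex_product_arc_iff[OF factors disjoint k(1) i _ k(2)] arc u x by blast
qed

text \<open>A neighbour \<open>u\<close> outside \<open>F i\<close> survives the exchange. If
  \<open>u\<close> lies in \<open>F i\<close>, then \<open>y\<close> replaces it for
  \<open>v\<close> inside \<open>F i\<close>, and \<open>x\<close> replaces it for \<open>v\<close>
  outside, by the module property.\<close>

lemma neighbour_after_exchange:
  assumes ij: "(i, j) \<in> parcs G" and x: "x \<in> pverts (F i)" and y: "y \<in> pverts (F j)"
    and u: "u \<in> S" "(v, u) \<in> parcs H"
  shows "\<exists>w\<in>insert x (insert y (S - pverts (F i))). (v, w) \<in> parcs H"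
proof (cases "u \<in> pverts (F i)")
  case True
  then show ?thesis
    using arc_between_fibres[OF ij _ y] arc_from_outside_fibre[OF G.in_arcsD1[OF ij] u(2) True _ x]
    by blast
qed (use u in blast)

lemma minimum_set_misses_fibre:
  assumes P: "P = dominating \<or> P = total_dominating" and S: "S \<in> min_sets P H"
    and i: "i \<in> pverts G"
  shows "pverts (F i) - S \<noteq> {}"
proof
  assume "pverts (F i) - S = {}"
  then have sub: "pverts (F i) \<subseteq> S" by blast
  have PS: "P H S" and min: "card S = min_card P H" using S by (auto simp: min_sets_def)
  have SH: "S \<subseteq> pverts H" using P PS by (auto simp: dominating_def total_dominating_def)
  obtain j where ij: "(i, j) \<in> parcs G"
    using G.connected_imp_neighbour[OF connected card_ge2 i] .
  have j: "j \<in> pverts G" using G.in_arcsD2[OF ij] .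
  obtain x where x: "x \<in> pverts (F i)" using card_fibre[OF i] by fastforce
  obtain y where y: "y \<in> pverts (F j)" using card_fibre[OF j] by fastforce
  define T where "T = insert x (insert y (S - pverts (F i)))"
  have TH: "T \<subseteq> pverts H" using SH i j x y by (auto simp: T_def pverts_H)
  have nbr: "\<exists>w\<in>T. (v, w) \<in> parcs H" if "u \<in> S" "(v, u) \<in> parcs H" for u v
    using neighbour_after_exchange[OF ij x y that] unfolding T_def .
  \<comment> \<open>Plain domination gives a vertex of \<open>S\<close> no neighbour in
    \<open>S\<close>, so the vertices that drop out need their own argument: they lie in
    \<open>F i\<close> and are adjacent to \<open>y\<close>.\<close>
  have removed: "\<exists>w\<in>T. (v, w) \<in> parcs H" if "v \<in> S - T" for v
    using that arc_between_fibres[OF ij _ y] by (auto simp: T_def)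
  have "dominating H T" if dom: "dominating H S"
    unfolding dominating_def
  proof (intro conjI ballI TH)
    fix v assume v: "v \<in> pverts H - T"
    show "\<exists>w\<in>T. (v, w) \<in> parcs H"
    proof (cases "v \<in> S")
      case False
      then obtain u where "u \<in> S" "(v, u) \<in> parcs H"
        using v dom unfolding dominating_def by blast
      then show ?thesis by (rule nbr)
    qed (use v removed in blast)
  qed
  moreover have "total_dominating H T" if tot: "total_dominating H S"
    unfolding total_dominating_def
  proof (intro conjI ballI TH)
    fix v assume "v \<in> pverts H"
    then obtain u where "u \<in> S" "(v, u) \<in> parcs H"
      using tot unfolding total_dominating_def by blast
    then show "\<exists>w\<in>T. (v, w) \<in> parcs H" by (rule nbr)
  qed
  ultimately have "P H T" using P PS by (elim disjE) simp_all
  then have "card S \<le> card T" unfolding min by (rule min_card_le)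
  moreover have "card T < card S"
    unfolding T_def using card_exchange_less[OF _ sub card_fibre[OF i]] SH
      finite_subset[OF SH H.pair_finite_verts] by blast
  ultimately show False by simp
qed

text \<open>To be applied to the complement of a minimum set. A neighbour of \<open>v\<close> is
  found in any fibre adjacent to that of \<open>v\<close>; connectedness comes from lifting walks of
  \<open>G\<close> to \<open>S\<close>.\<close>

lemma
  assumes S: "S \<subseteq> pverts H" and meets: "\<And>i. i \<in> pverts G \<Longrightarrow> pverts (F i) \<inter> S \<noteq> {}"
  shows neighbour_in_transversal: "v \<in> pverts H \<Longrightarrow> \<exists>u\<in>S. (v, u) \<in> parcs H"
    and connected_transversal: "Digraph_Component.connected (with_proj H \<restriction> S)"
proof -
  show nbr: "\<exists>u\<in>S. (v, u) \<in> parcs H" if v: "v \<in> pverts H" for v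
  proof -
    obtain i where i: "i \<in> pverts G" "v \<in> pverts (F i)" using v pverts_H by blast
    obtain j where ij: "(i, j) \<in> parcs G"
      using G.connected_imp_neighbour[OF connected card_ge2 i(1)] .
    obtain u where "u \<in> pverts (F j)" "u \<in> S" using meets[OF G.in_arcsD2[OF ij]] by blast
    then show ?thesis using arc_between_fibres[OF ij i(2)] by blast
  qed
  interpret K: wf_digraph "with_proj H \<restriction> S" by (rule H.wellformed_induce_subgraph)
  have adj: "u \<rightarrow>\<^bsub>with_proj H \<restriction> S\<^esub> v" if "(u, v) \<in> parcs H" "u \<in> S" "v \<in> S" for u v
    using that by (auto simp: arcs_ends_conv intro!: image_eqI[of _ _ "(u, v)"])
  have reach: "x \<rightarrow>\<^sup>*\<^bsub>with_proj H \<restriction> S\<^esub> y"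
    if "i \<rightarrow>\<^sup>*\<^bsub>with_proj G\<^esub> j" "x \<in> pverts (F i) \<inter> S" "y \<in> pverts (F j) \<inter> S" for i j x y
    using that
  proof (induction arbitrary: x rule: G.converse_reachable_induct)
    \<comment> \<open>Here \<open>x\<close> and \<open>y\<close> share the fibre \<open>F j\<close>,
      which may have no arcs at all; a detour through a vertex of \<open>S\<close> in an adjacent
      fibre \<open>F k\<close> joins them.\<close>
    case base
    then have j: "j \<in> pverts G" by simp
    obtain k where jk: "(j, k) \<in> parcs G"
      using G.connected_imp_neighbour[OF connected card_ge2 j] .
    have kj: "(k, j) \<in> parcs G" using jk G.arcs_symmetric by blast
    obtain z where "z \<in> pverts (F k)" "z \<in> S" using meets[OF G.in_arcsD2[OF jk]] by blast
    then have "x \<rightarrow>\<^bsub>with_proj H \<restriction> S\<^esub> z" "z \<rightarrow>\<^bsub>with_proj H \<restriction> S\<^esub> y"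
      using base adj arc_between_fibres[OF jk] arc_between_fibres[OF kj] by blast+
    then show ?case using K.adj_reachable_trans K.reachable_adjI by blast
  next
    case (step i k)
    then have ik: "(i, k) \<in> parcs G" by simp
    \<comment> \<open>The step from \<open>i\<close> to \<open>k\<close> lifts to an arc from
      \<open>x\<close> to any vertex of \<open>S\<close> in \<open>F k\<close>.\<close>
    obtain z where z: "z \<in> pverts (F k)" "z \<in> S" using meets[OF G.in_arcsD2[OF ik]] by blast
    then have "x \<rightarrow>\<^bsub>with_proj H \<restriction> S\<^esub> z"
      using step.prems adj arc_between_fibres[OF ik] by blast
    moreover have "z \<rightarrow>\<^sup>*\<^bsub>with_proj H \<restriction> S\<^esub> y" using step.IH step.prems z by blast
    ultimately show ?case using K.adj_reachable_trans by blast
  qed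
  have sc: "strongly_connected (with_proj G)"
    using connected G.symmetric_connected_imp_strongly_connected G.sym_arcs by blast
  show "Digraph_Component.connected (with_proj H \<restriction> S)"
  proof (rule K.connectedI)
    show "verts (with_proj H \<restriction> S) \<noteq> {}"
      using sc meets by (auto simp: strongly_connected_def)
    fix u v assume "u \<in> verts (with_proj H \<restriction> S)" "v \<in> verts (with_proj H \<restriction> S)"
    then have uv: "u \<in> S" "v \<in> S" by simp_all
    then obtain i j where ij: "i \<in> pverts G" "u \<in> pverts (F i)" "j \<in> pverts G" "v \<in> pverts (F j)"
      using S pverts_H by blast
    then have "i \<rightarrow>\<^sup>*\<^bsub>with_proj G\<^esub> j" using sc by (simp add: strongly_connected_def)
    then have "u \<rightarrow>\<^sup>*\<^bsub>with_proj H \<restriction> S\<^esub> v" using uv ij by (intro reach) auto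
    then show "u \<rightarrow>\<^sup>*\<^bsub>with_proj (mk_symmetric (with_proj H \<restriction> S))\<^esub> v"
      by (rule K.reachable_mk_symmetricI)
  qed
qed

text \<open>The complement of \<open>S\<close> meets every fibre, so the two facts about such sets
  yield the restrained and the outer-connected condition. Total domination implies domination, which
  lets one argument serve both kinds of minimum set.\<close>

lemma minimum_set_complement:
  assumes "P = dominating \<or> P = total_dominating" "S \<in> min_sets P H"
  shows "restrained_dominating H S" "outer_connected_dominating H S"
proof -
  have meets: "pverts (F i) \<inter> (pverts H - S) \<noteq> {}" if "i \<in> pverts G" for i
    using minimum_set_misses_fibre[OF assms that] that pverts_H by blast
  have "dominating H S"
    using assms by (auto simp: min_sets_def dominating_def total_dominating_def)
  then show "restrained_dominating H S" "outer_connected_dominating H S"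
    unfolding restrained_dominating_def outer_connected_dominating_def
    using neighbour_in_transversal[OF Diff_subset meets] connected_transversal[OF Diff_subset meets]
    by simp_all
qed

lemma strongly_equal_domination:
  shows "strongly_equal H dominating restrained_dominating"
    and "strongly_equal H dominating outer_connected_dominating"
proof -
  note min = minimum_set_complement[of dominating, OF disjI1[OF refl]]
  show "strongly_equal H dominating restrained_dominating"
    by (rule strongly_equalI) (erule min, simp add: restrained_dominating_def)
  show "strongly_equal H dominating outer_connected_dominating"
    by (rule strongly_equalI) (erule min, simp add: outer_connected_dominating_def)
qed

lemma strongly_equal_total_domination:
  shows "strongly_equal H total_dominating total_restrained_dominating"
    and "strongly_equal H total_dominating total_outer_connected_dominating"
proof -
  have "total_dominating H S" if "S \<in> min_sets total_dominating H" for S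
    using that by (simp add: min_sets_def)
  note min = this minimum_set_complement[of total_dominating, OF disjI2[OF refl]]
  show "strongly_equal H total_dominating total_restrained_dominating"
    by (rule strongly_equalI) (simp_all add: min total_restrained_dominating_def)
  show "strongly_equal H total_dominating total_outer_connected_dominating"
    by (rule strongly_equalI) (simp_all add: min total_outer_connected_dominating_def)
qed

end

theorem theorem2p8:
  fixes n :: nat and G :: "nat pair_pre_digraph" and F :: "nat \<Rightarrow> 'a pair_pre_digraph"
  assumes "n \<ge> 2"
    and "pair_graph G" and "pverts G = {1..n}" and "Digraph_Component.connected (with_proj G)"
    and "\<And>i. i \<in> {1..n} \<Longrightarrow> pair_graph (F i)"
    and "disjoint_family_on (\<lambda>i. pverts (F i)) {1..n}"
    and "\<And>i. i \<in> {1..n} \<Longrightarrow> card (pverts (F i)) \<ge> 3"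
  shows "(strongly_equal (lex_product G F) dominating restrained_dominating \<and>
          strongly_equal (lex_product G F) restrained_dominating outer_connected_dominating) \<and>
         (strongly_equal (lex_product G F) total_dominating total_restrained_dominating \<and>
          strongly_equal (lex_product G F) total_restrained_dominating
            total_outer_connected_dominating)"
proof -
  interpret connected_lex_product G F
    using assms by (auto simp: connected_lex_product_def connected_lex_product_axioms_def)
  \<comment> \<open>The restrained and outer-connected variants were each compared with the plain
    one; strong equality is equality of families of sets, so transitivity relates them to each
    other.\<close>
  show ?thesis
    using strongly_equal_domination strongly_equal_total_domination
    by (simp add: strongly_equal_def)
qed

end
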